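(* Let $\mathbf C$ be an IT-category with an accuracy relation $\vartriangleright$, let $\mathcal D$ be an object of $\mathbf C$, and let $\mathfrak J(\mathcal D)$ be the family of informativeness equivalence classes $[a]$ of morphisms $a$ of $\mathbf C$ with source $\mathcal D$. Then $\mathfrak J(\mathcal D)$, with $$[a]\succcurlyeq[b]\iff a\succcurlyeq b,\qquad [a]*[b]:=[a*b],\qquad \mathbf 0:=[z_{\mathcal D}],\qquad \mathbf 1:=[i_{\mathcal D}]$$ (which are well defined), forms a partially ordered Abelian monoid $\langle\mathfrak J(\mathcal D),\succcurlyeq,*,\mathbf 0\rangle$ with smallest element $\mathbf 0$ and largest element $\mathbf 1$. Moreover, for all $\mathbf a,\mathbf b,\mathbf c,\mathbf e\in\mathfrak J(\mathcal D)$: (a) $\mathbf 0*\mathbf a=\mathbf a$; (b) $\mathbf 1*\mathbf a=\mathbf 1$; (c) $\mathbf 0\preccurlyeq\mathbf a\preccurlyeq\mathbf 1$; (d) $\mathbf a*\mathbf b\succcurlyeq\mathbf a$ and $\mathbf a*\mathbf b\succcurlyeq\mathbf b$; (e) if $\mathbf a\succcurlyeq\mathbf b$ and $\mathbf c\succcurlyeq\mathbf e$, then $\mathbf a*\mathbf c\succcurlyeq\mathbf b*\mathbf e$.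
   Context: A category of information transformers (IT-category) is a category $\mathbf C$ (composition $\circ$, identities $i_{\mathcal A}$) such that: (1) there is a fixed subcategory $\mathbf D$ (of deterministic ITs) containing all objects of $\mathbf C$; (2) the isomorphisms of $\mathbf C$ and of $\mathbf D$ coincide; (3) $\mathbf C$ and $\mathbf D$ have a common terminal object $\mathcal Z$; the unique morphism $\mathcal A\to\mathcal Z$ is denoted $z_{\mathcal A}$; (4) $\mathbf D$ has (chosen) pairwise products $\mathcal A\times\mathcal B$ with projections $\pi_{\mathcal A,\mathcal B}$, $\nu_{\mathcal A,\mathcal B}$ onto $\mathcal A$, $\mathcal B$; for $a:\mathcal D\to\mathcal A$, $b:\mathcal D\to\mathcal B$ in $\mathbf D$ the induced morphism is denoted $a*b:\mathcal D\to\mathcal A\times\mathcal B$; (5) the operation $*$ is extended (by specified structure) to all pairs of morphisms $a:\mathcal D\to\mathcal A$, $b:\mathcal D\to\mathcal B$ of $\mathbf C$, so that $\pi_{\mathcal A,\mathcal B}\circ(a*b)=a$ and $\nu_{\mathcal A,\mathcal B}\circ(a*b)=b$ (uniqueness is not required in $\mathbf C$); (6) for $a:\mathcal A\to\mathcal C$, $b:\mathcal B\to\mathcal E$ in $\mathbf C$, with $a\times b:=(a\circ\pi_{\mathcal A,\mathcal B})*(b\circ\nu_{\mathcal A,\mathcal B})$, one has $(a\times b)\circ(c*d)=(a\circ c)*(b\circ d)$ for all $c:\mathcal D\to\mathcal A$, $d:\mathcal D\to\mathcal B$ in $\mathbf C$; (7) with $\sigma_{\mathcal A,\mathcal B}:=\nu_{\mathcal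 A,\mathcal B}*\pi_{\mathcal A,\mathcal B}$, one has $\sigma_{\mathcal A,\mathcal B}\circ(a*b)=b*a$ in $\mathbf C$; (8) with $\alpha_{\mathcal A,\mathcal B,\mathcal C}:=(\pi_{\mathcal A,\mathcal B}\circ\pi_{\mathcal A\times\mathcal B,\mathcal C})*\bigl((\nu_{\mathcal A,\mathcal B}\circ\pi_{\mathcal A\times\mathcal B,\mathcal C})*\nu_{\mathcal A\times\mathcal B,\mathcal C}\bigr)$, one has $\alpha_{\mathcal A,\mathcal B,\mathcal C}\circ((a*b)*c)=a*(b*c)$ in $\mathbf C$. An accuracy relation on $\mathbf C$ is a partial order $\vartriangleright$ on each hom-set $\mathbf C(\mathcal A,\mathcal B)$ such that $a\vartriangleright a'$, $b\vartriangleright b'$ imply $a\circ b\vartriangleright a'\circ b'$ and $a*b\vartriangleright a'*b'$ (whenever these are defined). For $a:\mathcal D\to\mathcal A$, $b:\mathcal D\to\mathcal B$: $a\succcurlyeq b$ ($a$ is more informative than $b$) if there is $c:\mathcal A\to\mathcal B$ with $c\circ a\vartriangleright b$. Informativeness equivalence: $a\sim b$ iff $a\succcurlyeq b$ and $b\succcurlyeq a$; $[a]$ is the class of $a$. $\preccurlyeq$ is the converse of $\succcurlyeq$. *)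

theory Defs
  imports "HOL-Algebra.Group"
begin

(* A category is given by its sets of objects and of morphisms.  Comp g f is the composite of g
   after f; it is relevant only if Cod f = Dom g, and its other values are arbitrary. *)

record ('o, 'm) cat =
  Ob :: "'o set"
  Mor :: "'m set"
  Dom :: "'m \<Rightarrow> 'o"
  Cod :: "'m \<Rightarrow> 'o"
  Ident :: "'o \<Rightarrow> 'm"
  Comp :: "'m \<Rightarrow> 'm \<Rightarrow> 'm" (infixr "\<odot>\<index>" 72)

definition Hom :: "('o, 'm, 'x) cat_scheme \<Rightarrow> 'o \<Rightarrow> 'o \<Rightarrow> 'm set" where
  "Hom C A B = {f \<in> Mor C. Dom C f = A \<and> Cod C f = B}"

locale category =
  fixes C :: "('o, 'm, 'x) cat_scheme" (structure)
  assumes Dom_Cod_Ob: "f \<in> Mor C \<Longrightarrow> Dom C f \<in> Ob C \<and> Cod C f \<in> Ob C"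
    and Ident_Hom: "A \<in> Ob C \<Longrightarrow> Ident C A \<in> Hom C A A"
    and Comp_Hom: "\<lbrakk>f \<in> Hom C A B; g \<in> Hom C B E\<rbrakk> \<Longrightarrow> g \<odot> f \<in> Hom C A E"
    and Comp_assoc: "\<lbrakk>f \<in> Hom C A B; g \<in> Hom C B E; h \<in> Hom C E F\<rbrakk>
          \<Longrightarrow> (h \<odot> g) \<odot> f = h \<odot> (g \<odot> f)"
    and Comp_Ident: "f \<in> Hom C A B \<Longrightarrow> f \<odot> Ident C A = f"
    and Ident_Comp: "f \<in> Hom C A B \<Longrightarrow> Ident C B \<odot> f = f"

definition isos :: "('o, 'm, 'x) cat_scheme \<Rightarrow> 'm set" where
  "isos C = {f \<in> Mor C. \<exists>g \<in> Hom C (Cod C f) (Dom C f).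
     g \<odot>\<^bsub>C\<^esub> f = Ident C (Dom C f) \<and> f \<odot>\<^bsub>C\<^esub> g = Ident C (Cod C f)}"

definition terminal :: "('o, 'm, 'x) cat_scheme \<Rightarrow> 'o \<Rightarrow> bool" where
  "terminal C Z \<longleftrightarrow> Z \<in> Ob C \<and> (\<forall>A \<in> Ob C. \<exists>!f. f \<in> Hom C A Z)"

definition is_product ::
    "('o, 'm, 'x) cat_scheme \<Rightarrow> 'o \<Rightarrow> 'o \<Rightarrow> 'o \<Rightarrow> 'm \<Rightarrow> 'm \<Rightarrow> bool" where
  "is_product C A B P p q \<longleftrightarrow> p \<in> Hom C P A \<and> q \<in> Hom C P B \<and>
     (\<forall>D \<in> Ob C. \<forall>a \<in> Hom C D A. \<forall>b \<in> Hom C D B.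
        \<exists>!h. h \<in> Hom C D P \<and> p \<odot>\<^bsub>C\<^esub> h = a \<and> q \<odot>\<^bsub>C\<^esub> h = b)"

record ('o, 'm) it_cat = "('o, 'm) cat" +
  Det :: "'m set"
  Zobj :: 'o
  Prod :: "'o \<Rightarrow> 'o \<Rightarrow> 'o"
  Proj1 :: "'o \<Rightarrow> 'o \<Rightarrow> 'm"
  Proj2 :: "'o \<Rightarrow> 'o \<Rightarrow> 'm"
  Pair :: "'m \<Rightarrow> 'm \<Rightarrow> 'm" (infixr "\<star>\<index>" 71)

(* The subcategory of deterministic morphisms: it has all objects of C. *)
definition det_cat :: "('o, 'm, 'x) it_cat_scheme \<Rightarrow> ('o, 'm, 'x) it_cat_scheme" where
  "det_cat C = C\<lparr>Mor := Det C\<rparr>"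

definition cross :: "('o, 'm, 'x) it_cat_scheme \<Rightarrow> 'm \<Rightarrow> 'm \<Rightarrow> 'm" where
  "cross C a b =
     (a \<odot>\<^bsub>C\<^esub> Proj1 C (Dom C a) (Dom C b)) \<star>\<^bsub>C\<^esub> (b \<odot>\<^bsub>C\<^esub> Proj2 C (Dom C a) (Dom C b))"

definition swap :: "('o, 'm, 'x) it_cat_scheme \<Rightarrow> 'o \<Rightarrow> 'o \<Rightarrow> 'm" where
  "swap C A B = Proj2 C A B \<star>\<^bsub>C\<^esub> Proj1 C A B"

definition assoc :: "('o, 'm, 'x) it_cat_scheme \<Rightarrow> 'o \<Rightarrow> 'o \<Rightarrow> 'o \<Rightarrow> 'm" where
  "assoc C A B E =
     (Proj1 C A B \<odot>\<^bsub>C\<^esub> Proj1 C (Prod C A B) E) \<star>\<^bsub>C\<^esub>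
     ((Proj2 C A B \<odot>\<^bsub>C\<^esub> Proj1 C (Prod C A B) E) \<star>\<^bsub>C\<^esub> Proj2 C (Prod C A B) E)"

locale it_category = category C
  for C :: "('o, 'm, 'x) it_cat_scheme" (structure) +
  assumes Det_subset: "Det C \<subseteq> Mor C"
    and category_det: "category (det_cat C)"
    and isos_det: "isos (det_cat C) = isos C"
    and terminal: "terminal C (Zobj C)"
    and terminal_det: "terminal (det_cat C) (Zobj C)"
    and product_det: "\<lbrakk>A \<in> Ob C; B \<in> Ob C\<rbrakk>
          \<Longrightarrow> is_product (det_cat C) A B (Prod C A B) (Proj1 C A B) (Proj2 C A B)"
    (* together with Proj_Pair: on Det, Pair is the morphism induced by the universal property *)
    and Pair_Det: "\<lbrakk>a \<in> Det C; b \<in> Det C; Dom C a = Dom C b\<rbrakk> \<Longrightarrow> a \<star> b \<in> Det C"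
    and Pair_Hom: "\<lbrakk>a \<in> Hom C D A; b \<in> Hom C D B\<rbrakk> \<Longrightarrow> a \<star> b \<in> Hom C D (Prod C A B)"
    and Proj_Pair: "\<lbrakk>a \<in> Hom C D A; b \<in> Hom C D B\<rbrakk>
          \<Longrightarrow> Proj1 C A B \<odot> (a \<star> b) = a \<and> Proj2 C A B \<odot> (a \<star> b) = b"
    and cross_Pair: "\<lbrakk>a \<in> Hom C A A'; b \<in> Hom C B B'; c \<in> Hom C D A; d \<in> Hom C D B\<rbrakk>
          \<Longrightarrow> cross C a b \<odot> (c \<star> d) = (a \<odot> c) \<star> (b \<odot> d)"
    and swap_Pair: "\<lbrakk>a \<in> Hom C D A; b \<in> Hom C D B\<rbrakk> \<Longrightarrow> swap C A B \<odot> (a \<star> b) = b \<star> a"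
    and assoc_Pair: "\<lbrakk>a \<in> Hom C D A; b \<in> Hom C D B; c \<in> Hom C D E\<rbrakk>
          \<Longrightarrow> assoc C A B E \<odot> ((a \<star> b) \<star> c) = a \<star> (b \<star> c)"

(* (a, a') in acc A B means that a is at least as accurate as a', for a and a' from A to B. *)
definition accuracy_relation ::
    "('o, 'm, 'x) it_cat_scheme \<Rightarrow> ('o \<Rightarrow> 'o \<Rightarrow> ('m \<times> 'm) set) \<Rightarrow> bool" where
  "accuracy_relation C acc \<longleftrightarrow>
     (\<forall>A \<in> Ob C. \<forall>B \<in> Ob C. partial_order_on (Hom C A B) (acc A B)) \<and>
     (\<forall>A \<in> Ob C. \<forall>B \<in> Ob C. \<forall>E \<in> Ob C. \<forall>a a' b b'.
        (a, a') \<in> acc B E \<longrightarrow> (b, b') \<in> acc A B \<longrightarrow> (a \<odot>\<^bsub>C\<^esub> b, a' \<odot>\<^bsub>C\<^esub> b') \<in> acc A E) \<and>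
     (\<forall>D \<in> Ob C. \<forall>A \<in> Ob C. \<forall>B \<in> Ob C. \<forall>a a' b b'.
        (a, a') \<in> acc D A \<longrightarrow> (b, b') \<in> acc D B \<longrightarrow>
        (a \<star>\<^bsub>C\<^esub> b, a' \<star>\<^bsub>C\<^esub> b') \<in> acc D (Prod C A B))"

definition Out :: "('o, 'm, 'x) cat_scheme \<Rightarrow> 'o \<Rightarrow> 'm set" where
  "Out C D = {a \<in> Mor C. Dom C a = D}"

definition to_terminal :: "('o, 'm, 'x) it_cat_scheme \<Rightarrow> 'o \<Rightarrow> 'm" where
  "to_terminal C A = (THE f. f \<in> Hom C A (Zobj C))"

(* The pairs (a, b) of morphisms with source D such that a is more informative than b. *)
definition informative ::
    "('o, 'm, 'x) it_cat_scheme \<Rightarrow> ('o \<Rightarrow> 'o \<Rightarrow> ('m \<times> 'm) set) \<Rightarrow> 'o \<Rightarrow> ('m \<times> 'm) set" where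
  "informative C acc D = {(a, b). a \<in> Out C D \<and> b \<in> Out C D \<and>
     (\<exists>c \<in> Hom C (Cod C a) (Cod C b). (c \<odot>\<^bsub>C\<^esub> a, b) \<in> acc D (Cod C b))}"

definition info_equiv ::
    "('o, 'm, 'x) it_cat_scheme \<Rightarrow> ('o \<Rightarrow> 'o \<Rightarrow> ('m \<times> 'm) set) \<Rightarrow> 'o \<Rightarrow> ('m \<times> 'm) set" where
  "info_equiv C acc D = {(a, b). (a, b) \<in> informative C acc D \<and> (b, a) \<in> informative C acc D}"

definition info_class ::
    "('o, 'm, 'x) it_cat_scheme \<Rightarrow> ('o \<Rightarrow> 'o \<Rightarrow> ('m \<times> 'm) set) \<Rightarrow> 'o \<Rightarrow> 'm \<Rightarrow> 'm set" where
  "info_class C acc D a = info_equiv C acc D `` {a}"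

definition Inf_classes ::
    "('o, 'm, 'x) it_cat_scheme \<Rightarrow> ('o \<Rightarrow> 'o \<Rightarrow> ('m \<times> 'm) set) \<Rightarrow> 'o \<Rightarrow> 'm set set" where
  "Inf_classes C acc D = Out C D // info_equiv C acc D"

(* Order and product of classes are stated through arbitrary representatives; the product is the
   usual union over representatives, which is a single class by well-definedness. *)

definition Inf_order ::
    "('o, 'm, 'x) it_cat_scheme \<Rightarrow> ('o \<Rightarrow> 'o \<Rightarrow> ('m \<times> 'm) set) \<Rightarrow> 'o \<Rightarrow> ('m set \<times> 'm set) set" where
  "Inf_order C acc D = {(X, Y). X \<in> Inf_classes C acc D \<and> Y \<in> Inf_classes C acc D \<and>
     (\<exists>a \<in> X. \<exists>b \<in> Y. (a, b) \<in> informative C acc D)}"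

definition Inf_monoid ::
    "('o, 'm, 'x) it_cat_scheme \<Rightarrow> ('o \<Rightarrow> 'o \<Rightarrow> ('m \<times> 'm) set) \<Rightarrow> 'o \<Rightarrow> 'm set monoid" where
  "Inf_monoid C acc D = \<lparr>carrier = Inf_classes C acc D,
     mult = (\<lambda>X Y. \<Union>a \<in> X. \<Union>b \<in> Y. info_class C acc D (a \<star>\<^bsub>C\<^esub> b)),
     one = info_class C acc D (to_terminal C D)\<rparr>"

(* The largest class; it is not the neutral element of the monoid above. *)
definition Inf_top ::
    "('o, 'm, 'x) it_cat_scheme \<Rightarrow> ('o \<Rightarrow> 'o \<Rightarrow> ('m \<times> 'm) set) \<Rightarrow> 'o \<Rightarrow> 'm set" where
  "Inf_top C acc D = info_class C acc D (Ident C D)"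

definition po_comm_monoid :: "('a, 'b) monoid_scheme \<Rightarrow> ('a \<times> 'a) set \<Rightarrow> bool" where
  "po_comm_monoid M r \<longleftrightarrow> comm_monoid M \<and> partial_order_on (carrier M) r \<and>
     (\<forall>x \<in> carrier M. \<forall>y \<in> carrier M. \<forall>z \<in> carrier M.
        (x, y) \<in> r \<longrightarrow> (x \<otimes>\<^bsub>M\<^esub> z, y \<otimes>\<^bsub>M\<^esub> z) \<in> r)"

end

theory Submission
  imports Defs
begin

text \<open>
  Everything reduces to a preorder on the morphisms out of \<open>D\<close>: the product morphism \<open>c \<times> d\<close>
  transports \<open>a * b\<close> along \<open>c\<close> and \<open>d\<close>, so \<open>*\<close> is monotone; the projections make \<open>a * b\<close> an upper
  bound of \<open>a\<close> and \<open>b\<close>; swapping and reassociating give the laws of a commutative monoid up to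
  equivalence. The only point that needs the subcategory of deterministic morphisms is that \<open>a\<close> is
  at least as informative as \<open>z * a\<close>: for nondeterministic \<open>a\<close> pairing does not commute with
  precomposition by \<open>a\<close>, but the second projection from \<open>Z \<times> A\<close> is invertible with inverse
  \<open>z * i\<close> by the uniqueness of morphisms into products of deterministic morphisms.
\<close>

section \<open>Hom-sets and morphisms with a given source\<close>

lemma Out_iff_Hom: "a \<in> Out C D \<longleftrightarrow> a \<in> Hom C D (Cod C a)"
  by (simp add: Out_def Hom_def)

lemma Hom_OutI: "a \<in> Hom C D A \<Longrightarrow> a \<in> Out C D"
  by (simp add: Out_def Hom_def)

lemma Hom_Cod: "a \<in> Hom C D A \<Longrightarrow> Cod C a = A"
  by (simp add: Hom_def)

lemma Hom_Dom: "a \<in> Hom C D A \<Longrightarrow> Dom C a = D"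
  by (simp add: Hom_def)

lemma Out_HomE:
  assumes "a \<in> Out C D"
  obtains A where "a \<in> Hom C D A"
  using assms by (auto simp: Out_def Hom_def)

lemma (in category) Hom_Ob: "f \<in> Hom C A B \<Longrightarrow> A \<in> Ob C \<and> B \<in> Ob C"
  using Dom_Cod_Ob by (auto simp: Hom_def)

section \<open>The deterministic subcategory, structural morphisms and the terminal object\<close>

context it_category
begin

lemma Hom_det_cat_iff:
  "f \<in> Hom (det_cat C) A B \<longleftrightarrow> f \<in> Det C \<and> Dom C f = A \<and> Cod C f = B"
  by (simp add: Hom_def det_cat_def)

lemma Hom_det_catD: "f \<in> Hom (det_cat C) A B \<Longrightarrow> f \<in> Hom C A B"
  unfolding Hom_det_cat_iff using Det_subset by (auto simp: Hom_def)

lemma Ob_det_cat [simp]: "Ob (det_cat C) = Ob C"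
  and Ident_det_cat [simp]: "Ident (det_cat C) = Ident C"
  and Comp_det_cat [simp]: "Comp (det_cat C) = Comp C"
  by (simp_all add: det_cat_def)

lemma Proj_det:
  assumes "A \<in> Ob C" "B \<in> Ob C"
  shows "Proj1 C A B \<in> Hom (det_cat C) (Prod C A B) A"
    and "Proj2 C A B \<in> Hom (det_cat C) (Prod C A B) B"
  using product_det[OF assms] by (auto simp: is_product_def)

lemma Proj_Hom:
  assumes "A \<in> Ob C" "B \<in> Ob C"
  shows "Proj1 C A B \<in> Hom C (Prod C A B) A" and "Proj2 C A B \<in> Hom C (Prod C A B) B"
  using Proj_det[OF assms] by (auto intro: Hom_det_catD)

lemma cross_Hom:
  assumes "a \<in> Hom C A A'" "b \<in> Hom C B B'"
  shows "cross C a b \<in> Hom C (Prod C A B) (Prod C A' B')"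
  using assms Hom_Ob[OF assms(1)] Hom_Ob[OF assms(2)]
  by (auto simp: cross_def Hom_Dom intro!: Pair_Hom Comp_Hom Proj_Hom)

lemma swap_Hom:
  assumes "A \<in> Ob C" "B \<in> Ob C"
  shows "swap C A B \<in> Hom C (Prod C A B) (Prod C B A)"
  unfolding swap_def by (intro Pair_Hom Proj_Hom assms)

lemma assoc_Hom:
  assumes "A \<in> Ob C" "B \<in> Ob C" "E \<in> Ob C"
  shows "assoc C A B E \<in> Hom C (Prod C (Prod C A B) E) (Prod C A (Prod C B E))"
proof -
  have "Prod C A B \<in> Ob C"
    using Proj_Hom[OF assms(1,2)] Hom_Ob by blast
  note Proj = Proj_Hom[OF this assms(3)] Proj_Hom[OF assms(1,2)]
  show ?thesis
    unfolding assoc_def by (intro Pair_Hom Comp_Hom[OF Proj(1)] Proj)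
qed

lemma to_terminal_eq:
  assumes "f \<in> Hom C A (Zobj C)"
  shows "to_terminal C A = f"
proof -
  have "\<exists>!f. f \<in> Hom C A (Zobj C)"
    using terminal Hom_Ob[OF assms] by (auto simp: terminal_def)
  then show ?thesis
    unfolding to_terminal_def using assms by (rule the1_equality)
qed

text \<open>The terminal object is common to both categories, so the unique deterministic morphism
  into it is also the unique morphism of \<open>C\<close>. Determinism is what later admits it to
  the universal property of products.\<close>

lemma to_terminal_det:
  assumes "A \<in> Ob C"
  shows "to_terminal C A \<in> Hom (det_cat C) A (Zobj C)"
proof -
  obtain f where "f \<in> Hom (det_cat C) A (Zobj C)"
    using terminal_det assms by (auto simp: terminal_def)
  then show ?thesis
    using to_terminal_eq Hom_det_catD by metis
qed

lemma to_terminal_Hom: "A \<in> Ob C \<Longrightarrow> to_terminal C A \<in> Hom C A (Zobj C)"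
  by (simp add: to_terminal_det Hom_det_catD)

lemma Zobj_Ob: "Zobj C \<in> Ob C"
  using terminal by (simp add: terminal_def)

text \<open>Both sides are deterministic endomorphisms of the product with the same two projections.
  Equality of projections decides only in the deterministic subcategory, so membership there is
  tracked along with membership in \<open>C\<close>.\<close>

lemma Pair_terminal_Proj2:
  assumes A: "A \<in> Ob C"
  shows "(to_terminal C A \<star> Ident C A) \<odot> Proj2 C (Zobj C) A = Ident C (Prod C (Zobj C) A)"
proof -
  interpret det: category "det_cat C"
    by (rule category_det)
  let ?Z = "Zobj C" and ?P = "Prod C (Zobj C) A"
  let ?p = "Proj1 C ?Z A" and ?q = "Proj2 C ?Z A"
  let ?i = "to_terminal C A \<star> Ident C A"
  note pq = Proj_det[OF Zobj_Ob A]
  note PQ = Proj_Hom[OF Zobj_Ob A]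
  have P: "?P \<in> Ob C"
    using PQ Hom_Ob by blast
  have z: "to_terminal C A \<in> Hom (det_cat C) A ?Z"
    by (rule to_terminal_det[OF A])
  have id: "Ident C A \<in> Hom (det_cat C) A A" "Ident C ?P \<in> Hom (det_cat C) ?P ?P"
    using det.Ident_Hom A P by simp_all
  have iC: "?i \<in> Hom C A ?P"
    using z id(1) by (intro Pair_Hom Hom_det_catD)
  have "?i \<in> Det C"
    using z id(1) by (intro Pair_Det) (auto simp: Hom_det_cat_iff)
  then have i: "?i \<in> Hom (det_cat C) A ?P"
    unfolding Hom_det_cat_iff using iC by (simp add: Hom_def)
  have iq: "?i \<odot> ?q \<in> Hom (det_cat C) ?P ?P"
    using det.Comp_Hom[OF pq(2) i] by simp
  \<comment> \<open>Agreement after \<open>?p\<close> is free, since its target is terminal.\<close>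
  have "?p \<odot> (?i \<odot> ?q) = to_terminal C ?P"
    using to_terminal_eq[OF Comp_Hom[OF Hom_det_catD[OF iq] PQ(1)]] by simp
  also have "\<dots> = ?p"
    by (rule to_terminal_eq[OF PQ(1)])
  finally have 1: "?p \<odot> (?i \<odot> ?q) = ?p" .
  have "?q \<odot> (?i \<odot> ?q) = (?q \<odot> ?i) \<odot> ?q"
    by (rule Comp_assoc[OF PQ(2) iC PQ(2), symmetric])
  also have "?q \<odot> ?i = Ident C A"
    using Proj_Pair[OF z[THEN Hom_det_catD] id(1)[THEN Hom_det_catD]] by simp
  also have "Ident C A \<odot> ?q = ?q"
    by (rule Ident_Comp[OF PQ(2)])
  finally have 2: "?q \<odot> (?i \<odot> ?q) = ?q" .
  \<comment> \<open>The universal property is applied to the cone formed by the projections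
    themselves, which the identity also mediates.\<close>
  have "\<exists>!h. h \<in> Hom (det_cat C) ?P ?P \<and> ?p \<odot> h = ?p \<and> ?q \<odot> h = ?q"
    using product_det[OF Zobj_Ob A] P pq by (simp add: is_product_def)
  then show ?thesis
    using iq id(2) 1 2 Comp_Ident[OF PQ(1)] Comp_Ident[OF PQ(2)] by blast
qed

end

section \<open>The informativeness preorder at a fixed source\<close>

locale accurate_it_category = it_category C
  for C :: "('o, 'm, 'x) it_cat_scheme" (structure) +
  fixes acc :: "'o \<Rightarrow> 'o \<Rightarrow> ('m \<times> 'm) set"
    and D :: 'o
  assumes accuracy: "accuracy_relation C acc"
    and D_Ob: "D \<in> Ob C"
begin

abbreviation geq (infix "\<succeq>" 50) where "a \<succeq> b \<equiv> (a, b) \<in> informative C acc D"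
abbreviation eqv (infix "\<simeq>" 50) where "a \<simeq> b \<equiv> (a, b) \<in> info_equiv C acc D"
abbreviation "cls \<equiv> info_class C acc D"
abbreviation "M \<equiv> Inf_monoid C acc D"

lemma acc_refl: "a \<in> Hom C A B \<Longrightarrow> (a, a) \<in> acc A B"
  using accuracy Hom_Ob[of a A B]
  by (auto simp: accuracy_relation_def partial_order_on_def preorder_on_def refl_on_def)

lemma acc_trans:
  assumes "A \<in> Ob C" "B \<in> Ob C" "(a, b) \<in> acc A B" "(b, c) \<in> acc A B"
  shows "(a, c) \<in> acc A B"
proof -
  have "trans (acc A B)"
    using accuracy assms(1,2)
    by (auto simp: accuracy_relation_def partial_order_on_def preorder_on_def)
  then show ?thesis
    using assms(3,4) by (rule transD)
qed

lemma acc_Comp: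
  assumes "A \<in> Ob C" "B \<in> Ob C" "E \<in> Ob C" "(a, a') \<in> acc B E" "(b, b') \<in> acc A B"
  shows "(a \<odot> b, a' \<odot> b') \<in> acc A E"
  using accuracy assms unfolding accuracy_relation_def by blast

lemma acc_Pair:
  assumes "E \<in> Ob C" "A \<in> Ob C" "B \<in> Ob C" "(a, a') \<in> acc E A" "(b, b') \<in> acc E B"
  shows "(a \<star> b, a' \<star> b') \<in> acc E (Prod C A B)"
  using accuracy assms unfolding accuracy_relation_def by blast

lemma geqI:
  assumes "a \<in> Hom C D A" "b \<in> Hom C D B" "c \<in> Hom C A B" "(c \<odot> a, b) \<in> acc D B"
  shows "a \<succeq> b"
  using assms by (auto simp: informative_def Hom_OutI Hom_Cod)

text \<open>Reflexivity of accuracy covers exact factorizations; comparisons through projections,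
  swaps, associators and terminal morphisms all take this form.\<close>

lemma geq_CompI:
  assumes "a \<in> Hom C D A" "c \<in> Hom C A B" "c \<odot> a = b"
  shows "a \<succeq> b"
proof -
  have "b \<in> Hom C D B"
    using Comp_Hom[OF assms(1,2)] assms(3) by simp
  then show ?thesis
    using assms acc_refl geqI[of a A b B c] by simp
qed

lemma geqE:
  assumes "a \<succeq> b"
  obtains A B c where "a \<in> Hom C D A" "b \<in> Hom C D B" "c \<in> Hom C A B" "(c \<odot> a, b) \<in> acc D B"
  using assms by (auto simp: informative_def Out_iff_Hom)

lemma geq_Out: "a \<succeq> b \<Longrightarrow> a \<in> Out C D \<and> b \<in> Out C D"
  by (auto simp: informative_def)

lemma geq_refl:
  assumes "a \<in> Out C D"
  shows "a \<succeq> a"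
proof -
  obtain A where a: "a \<in> Hom C D A"
    using assms by (rule Out_HomE)
  then have "A \<in> Ob C"
    using Hom_Ob by blast
  from geq_CompI[OF a Ident_Hom[OF this] Ident_Comp[OF a]] show ?thesis .
qed

lemma geq_trans:
  assumes "a \<succeq> b" "b \<succeq> e"
  shows "a \<succeq> e"
proof -
  obtain A B c where a: "a \<in> Hom C D A" and b: "b \<in> Hom C D B" and c: "c \<in> Hom C A B"
    and cab: "(c \<odot> a, b) \<in> acc D B"
    using assms(1) by (rule geqE)
  obtain B' E d where "b \<in> Hom C D B'" and e: "e \<in> Hom C D E" and "d \<in> Hom C B' E"
    and dbe: "(d \<odot> b, e) \<in> acc D E"
    using assms(2) by (rule geqE)
  \<comment> \<open>The two factorizations name the target of \<open>b\<close> separately; both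
    names equal \<open>Cod C b\<close>.\<close>
  then have d: "d \<in> Hom C B E"
    using b by (auto simp: Hom_def)
  have obs: "B \<in> Ob C" "E \<in> Ob C"
    using Hom_Ob[OF d] by auto
  \<comment> \<open>Monotonicity of composition lets \<open>d\<close> act on the first comparison,
    so \<open>d \<odot> c\<close> becomes the witness.\<close>
  have "(d \<odot> (c \<odot> a), d \<odot> b) \<in> acc D E"
    using acc_Comp[OF D_Ob obs acc_refl[OF d] cab] .
  then have "((d \<odot> c) \<odot> a, e) \<in> acc D E"
    using acc_trans[OF D_Ob obs(2) _ dbe] by (simp add: Comp_assoc[OF a c d])
  then show ?thesis
    using geqI[OF a e Comp_Hom[OF c d]] by simp
qed

section \<open>Pairing under the informativeness preorder\<close>

lemma Pair_Out: "a \<in> Out C D \<Longrightarrow> b \<in> Out C D \<Longrightarrow> a \<star> b \<in> Out C D"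
  by (elim Out_HomE) (blast intro: Hom_OutI Pair_Hom)

lemma Pair_mono:
  assumes "a \<succeq> b" "a' \<succeq> b'"
  shows "a \<star> a' \<succeq> b \<star> b'"
proof -
  obtain A B c where a: "a \<in> Hom C D A" and b: "b \<in> Hom C D B" and c: "c \<in> Hom C A B"
    and cab: "(c \<odot> a, b) \<in> acc D B"
    using assms(1) by (rule geqE)
  obtain A' B' c' where a': "a' \<in> Hom C D A'" and b': "b' \<in> Hom C D B'" and c': "c' \<in> Hom C A' B'"
    and cab': "(c' \<odot> a', b') \<in> acc D B'"
    using assms(2) by (rule geqE)
  \<comment> \<open>By \<open>cross_Pair\<close> the left side is the pair of
    \<open>c \<odot> a\<close> and \<open>c' \<odot> a'\<close>, and accuracy is monotone under
    pairing.\<close>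
  have "(cross C c c' \<odot> (a \<star> a'), b \<star> b') \<in> acc D (Prod C B B')"
    unfolding cross_Pair[OF c c' a a']
    using acc_Pair[OF D_Ob _ _ cab cab'] Hom_Ob[OF c] Hom_Ob[OF c'] by blast
  then show ?thesis
    by (rule geqI[OF Pair_Hom[OF a a'] Pair_Hom[OF b b'] cross_Hom[OF c c']])
qed

lemma Pair_geq:
  assumes "a \<in> Out C D" "b \<in> Out C D"
  shows "a \<star> b \<succeq> a" and "a \<star> b \<succeq> b"
proof -
  obtain A B where ab: "a \<in> Hom C D A" "b \<in> Hom C D B"
    using assms by (auto elim!: Out_HomE)
  have AB: "A \<in> Ob C" "B \<in> Ob C"
    using ab Hom_Ob by blast+
  show "a \<star> b \<succeq> a" "a \<star> b \<succeq> b"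
    using geq_CompI[OF Pair_Hom[OF ab] Proj_Hom(1)[OF AB]]
      geq_CompI[OF Pair_Hom[OF ab] Proj_Hom(2)[OF AB]] Proj_Pair[OF ab] by auto
qed

lemma Pair_swap_geq:
  assumes "a \<in> Out C D" "b \<in> Out C D"
  shows "a \<star> b \<succeq> b \<star> a"
proof -
  obtain A B where ab: "a \<in> Hom C D A" "b \<in> Hom C D B"
    using assms by (auto elim!: Out_HomE)
  then have "A \<in> Ob C" "B \<in> Ob C"
    using Hom_Ob by blast+
  from geq_CompI[OF Pair_Hom[OF ab] swap_Hom[OF this] swap_Pair[OF ab]] show ?thesis .
qed

lemma Pair_assoc_geq:
  assumes "a \<in> Out C D" "b \<in> Out C D" "c \<in> Out C D"
  shows "(a \<star> b) \<star> c \<succeq> a \<star> (b \<star> c)"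
proof -
  obtain A B E where abc: "a \<in> Hom C D A" "b \<in> Hom C D B" "c \<in> Hom C D E"
    using assms by (auto elim!: Out_HomE)
  then have "A \<in> Ob C" "B \<in> Ob C" "E \<in> Ob C"
    using Hom_Ob by blast+
  from geq_CompI[OF Pair_Hom[OF Pair_Hom[OF abc(1,2)] abc(3)] assoc_Hom[OF this]
      assoc_Pair[OF abc]]
  show ?thesis .
qed

text \<open>The converse needs no inverse of the associator: two cyclic rotations and a swap suffice.\<close>
lemma Pair_assoc_leq:
  assumes "a \<in> Out C D" "b \<in> Out C D" "c \<in> Out C D"
  shows "a \<star> (b \<star> c) \<succeq> (a \<star> b) \<star> c"
proof -
  have rotate: "x \<star> (y \<star> z) \<succeq> y \<star> (z \<star> x)"
    if "x \<in> Out C D" "y \<in> Out C D" "z \<in> Out C D" for x y z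
    using geq_trans[OF Pair_swap_geq Pair_assoc_geq] that by (simp add: Pair_Out)
  have "a \<star> (b \<star> c) \<succeq> c \<star> (a \<star> b)"
    using geq_trans[OF rotate rotate] assms by blast
  from geq_trans[OF this Pair_swap_geq] show ?thesis
    using assms by (simp add: Pair_Out)
qed

section \<open>Least and greatest elements, and the neutral law\<close>

lemma zero_Out: "to_terminal C D \<in> Out C D"
  using to_terminal_Hom[OF D_Ob] by (rule Hom_OutI)

lemma Ident_Out: "Ident C D \<in> Out C D"
  using Ident_Hom[OF D_Ob] by (rule Hom_OutI)

lemma geq_zero:
  assumes "a \<in> Out C D"
  shows "a \<succeq> to_terminal C D"
proof -
  obtain A where a: "a \<in> Hom C D A"
    using assms by (rule Out_HomE)
  then have z: "to_terminal C A \<in> Hom C A (Zobj C)"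
    using Hom_Ob to_terminal_Hom by blast
  show ?thesis
    using geq_CompI[OF a z to_terminal_eq[OF Comp_Hom[OF a z], symmetric]] .
qed

text \<open>The morphism \<open>a\<close> itself is the witness.\<close>

lemma Ident_geq:
  assumes "a \<in> Out C D"
  shows "Ident C D \<succeq> a"
proof -
  obtain A where a: "a \<in> Hom C D A"
    using assms by (rule Out_HomE)
  from geq_CompI[OF Ident_Hom[OF D_Ob] a Comp_Ident[OF a]] show ?thesis .
qed

text \<open>The nontrivial half of the neutral law; the other half is the second projection.\<close>

lemma geq_zero_Pair:
  assumes "a \<in> Out C D"
  shows "a \<succeq> to_terminal C D \<star> a"
proof -
  obtain A where a: "a \<in> Hom C D A"
    using assms by (rule Out_HomE)
  then have A: "A \<in> Ob C"
    using Hom_Ob by blast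
  let ?i = "to_terminal C A \<star> Ident C A" and ?q = "Proj2 C (Zobj C) A"
  let ?za = "to_terminal C D \<star> a"
  have za: "?za \<in> Hom C D (Prod C (Zobj C) A)"
    by (intro Pair_Hom a to_terminal_Hom D_Ob)
  have i: "?i \<in> Hom C A (Prod C (Zobj C) A)"
    by (intro Pair_Hom to_terminal_Hom Ident_Hom A)
  \<comment> \<open>Writing \<open>a\<close> as the second projection of \<open>?za\<close> lets
    \<open>?i \<odot> ?q\<close> cancel, so no rule for precomposing a pair with \<open>a\<close> is
    called for.\<close>
  have "?i \<odot> a = ?i \<odot> (?q \<odot> ?za)"
    using Proj_Pair[OF to_terminal_Hom[OF D_Ob] a] by simp
  also have "\<dots> = (?i \<odot> ?q) \<odot> ?za"
    by (rule Comp_assoc[OF za Proj_Hom(2)[OF Zobj_Ob A] i, symmetric])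
  also have "\<dots> = ?za"
    by (simp add: Pair_terminal_Proj2[OF A] Ident_Comp[OF za])
  finally show ?thesis
    by (rule geq_CompI[OF a i])
qed

section \<open>Passage to equivalence classes\<close>

lemma eqv_iff: "a \<simeq> b \<longleftrightarrow> a \<succeq> b \<and> b \<succeq> a"
  by (simp add: info_equiv_def)

lemma equiv_eqv: "equiv (Out C D) (info_equiv C acc D)"
proof (rule equivI)
  show "info_equiv C acc D \<subseteq> Out C D \<times> Out C D"
    using geq_Out by (auto simp: eqv_iff)
  show "refl_on (Out C D) (info_equiv C acc D)"
    by (auto simp: refl_on_def eqv_iff geq_refl)
  show "sym (info_equiv C acc D)"
    by (auto simp: sym_def eqv_iff)
  show "trans (info_equiv C acc D)"
    by (auto simp: trans_def eqv_iff intro: geq_trans)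
qed

lemma geq_cong: "a \<simeq> a' \<Longrightarrow> b \<simeq> b' \<Longrightarrow> a \<succeq> b \<longleftrightarrow> a' \<succeq> b'"
  unfolding eqv_iff using geq_trans by meson

lemma Pair_cong: "a \<simeq> a' \<Longrightarrow> b \<simeq> b' \<Longrightarrow> a \<star> b \<simeq> a' \<star> b'"
  unfolding eqv_iff by (blast intro: Pair_mono)

lemma cls_iff: "x \<in> cls a \<longleftrightarrow> a \<simeq> x"
  by (simp add: info_class_def)

lemma cls_eq_iff: "a \<in> Out C D \<Longrightarrow> b \<in> Out C D \<Longrightarrow> cls a = cls b \<longleftrightarrow> a \<simeq> b"
  unfolding info_class_def using eq_equiv_class_iff[OF equiv_eqv] .

lemma classes_eq: "Inf_classes C acc D = cls ` Out C D"
  by (auto simp: Inf_classes_def quotient_def info_class_def)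

lemma carrier_eq: "carrier M = cls ` Out C D"
  by (simp add: Inf_monoid_def classes_eq)

lemma one_eq: "\<one>\<^bsub>M\<^esub> = cls (to_terminal C D)"
  by (simp add: Inf_monoid_def)

text \<open>The order asks only for some pair of comparable representatives; \<open>geq_cong\<close>
  transfers the comparison to the given ones.\<close>

lemma order_cls_iff:
  assumes "a \<in> Out C D" "b \<in> Out C D"
  shows "(cls a, cls b) \<in> Inf_order C acc D \<longleftrightarrow> a \<succeq> b"
proof
  assume "(cls a, cls b) \<in> Inf_order C acc D"
  then obtain x y where "a \<simeq> x" "b \<simeq> y" "x \<succeq> y"
    by (auto simp: Inf_order_def cls_iff)
  then show "a \<succeq> b"
    using geq_cong by blast
next
  assume "a \<succeq> b"
  moreover have "a \<in> cls a" "b \<in> cls b"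
    using assms by (simp_all add: cls_iff eqv_iff geq_refl)
  ultimately show "(cls a, cls b) \<in> Inf_order C acc D"
    unfolding Inf_order_def classes_eq using assms by blast
qed

lemma mult_cls:
  assumes "a \<in> Out C D" "b \<in> Out C D"
  shows "cls a \<otimes>\<^bsub>M\<^esub> cls b = cls (a \<star> b)"
proof -
  have "cls (x \<star> y) = cls (a \<star> b)" if "x \<in> cls a" "y \<in> cls b" for x y
    using that equiv_class_eq[OF equiv_eqv Pair_cong, of a x b y]
    by (simp add: cls_iff info_class_def)
  \<comment> \<open>All members of the union coincide; these representatives show that it is not an
    empty union.\<close>
  moreover have "a \<in> cls a" "b \<in> cls b"
    using assms by (simp_all add: cls_iff eqv_iff geq_refl)
  ultimately show ?thesis
    unfolding Inf_monoid_def monoid.simps by blast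
qed

section \<open>The partially ordered commutative monoid of classes\<close>

lemma comm_monoid_M: "comm_monoid M"
proof (rule comm_monoidI)
  fix x y z
  assume "x \<in> carrier M" "y \<in> carrier M" "z \<in> carrier M"
  then show "(x \<otimes>\<^bsub>M\<^esub> y) \<otimes>\<^bsub>M\<^esub> z = x \<otimes>\<^bsub>M\<^esub> (y \<otimes>\<^bsub>M\<^esub> z)"
    \<comment> \<open>Equalities of classes are kept whole, not split into inclusions, so that
      \<open>cls_eq_iff\<close> reduces them to two comparisons of representatives.\<close>
    by (auto simp: carrier_eq mult_cls Pair_Out cls_eq_iff eqv_iff Pair_assoc_geq Pair_assoc_leq
        del: equalityI)
qed (auto simp: carrier_eq one_eq mult_cls Pair_Out zero_Out cls_eq_iff eqv_iff Pair_swap_geq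
      Pair_geq geq_zero_Pair del: equalityI)

lemma Inf_order_subset: "Inf_order C acc D \<subseteq> carrier M \<times> carrier M"
  by (auto simp: Inf_order_def Inf_monoid_def)

lemma partial_order_M: "partial_order_on (carrier M) (Inf_order C acc D)"
proof -
  have "refl_on (carrier M) (Inf_order C acc D)"
    by (auto simp: refl_on_def carrier_eq order_cls_iff geq_refl)
  moreover have "trans (Inf_order C acc D)"
  proof (rule transI)
    fix x y z
    assume xyz: "(x, y) \<in> Inf_order C acc D" "(y, z) \<in> Inf_order C acc D"
    then have "x \<in> cls ` Out C D" "y \<in> cls ` Out C D" "z \<in> cls ` Out C D"
      using Inf_order_subset by (auto simp: carrier_eq)
    then show "(x, z) \<in> Inf_order C acc D"
      using xyz by (auto simp: order_cls_iff intro: geq_trans)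
  qed
  \<comment> \<open>Mutual comparability of representatives is exactly their equivalence, hence
    equality of their classes.\<close>
  moreover have "antisym (Inf_order C acc D)"
  proof (rule antisymI)
    fix x y
    assume xy: "(x, y) \<in> Inf_order C acc D" "(y, x) \<in> Inf_order C acc D"
    then have "x \<in> cls ` Out C D" "y \<in> cls ` Out C D"
      using Inf_order_subset by (auto simp: carrier_eq)
    then show "x = y"
      using xy by (auto simp: order_cls_iff cls_eq_iff eqv_iff del: equalityI)
  qed
  ultimately show ?thesis
    using Inf_order_subset by (simp add: partial_order_on_def preorder_on_def)
qed

lemma po_comm_monoid_M: "po_comm_monoid M (Inf_order C acc D)"
  using comm_monoid_M partial_order_M
  by (auto simp: po_comm_monoid_def carrier_eq mult_cls order_cls_iff Pair_Out
      intro: Pair_mono geq_refl)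

end

theorem theorem7p5:
  fixes C :: "('o, 'm) it_cat"
    and acc :: "'o \<Rightarrow> 'o \<Rightarrow> ('m \<times> 'm) set"
    and D :: 'o
  assumes "it_category C"
    and "accuracy_relation C acc"
    and "D \<in> Ob C"
  shows
    "let cls = info_class C acc D;
         J = Inf_classes C acc D;
         M = Inf_monoid C acc D;
         J0 = \<one>\<^bsub>M\<^esub>;
         geq = (\<lambda>x y. (x, y) \<in> Inf_order C acc D);
         J1 = Inf_top C acc D
     in
       equiv (Out C D) (info_equiv C acc D) \<and>
       (\<forall>a a' b b'. (a, a') \<in> info_equiv C acc D \<longrightarrow> (b, b') \<in> info_equiv C acc D \<longrightarrow>
          ((a, b) \<in> informative C acc D \<longleftrightarrow> (a', b') \<in> informative C acc D) \<and>
          (a \<star>\<^bsub>C\<^esub> b, a' \<star>\<^bsub>C\<^esub> b') \<in> info_equiv C acc D) \<and>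
       (\<forall>a \<in> Out C D. \<forall>b \<in> Out C D.
          (geq (cls a) (cls b) \<longleftrightarrow> (a, b) \<in> informative C acc D) \<and>
          cls a \<otimes>\<^bsub>M\<^esub> cls b = cls (a \<star>\<^bsub>C\<^esub> b)) \<and>
       po_comm_monoid M (Inf_order C acc D) \<and>
       (J0 \<in> J \<and> (\<forall>x \<in> J. geq x J0)) \<and>
       (J1 \<in> J \<and> (\<forall>x \<in> J. geq J1 x)) \<and>
       (\<forall>a \<in> J. J0 \<otimes>\<^bsub>M\<^esub> a = a) \<and>
       (\<forall>a \<in> J. J1 \<otimes>\<^bsub>M\<^esub> a = J1) \<and>
       (\<forall>a \<in> J. geq a J0 \<and> geq J1 a) \<and>
       (\<forall>a \<in> J. \<forall>b \<in> J. geq (a \<otimes>\<^bsub>M\<^esub> b) a \<and> geq (a \<otimes>\<^bsub>M\<^esub> b) b) \<and>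
       (\<forall>a \<in> J. \<forall>b \<in> J. \<forall>c \<in> J. \<forall>e \<in> J.
          geq a b \<longrightarrow> geq c e \<longrightarrow> geq (a \<otimes>\<^bsub>M\<^esub> c) (b \<otimes>\<^bsub>M\<^esub> e))"
proof -
  interpret accurate_it_category C acc D
    using assms by (intro accurate_it_category.intro accurate_it_category_axioms.intro)
  show ?thesis
    \<comment> \<open>With the set of classes written as an image, each clause becomes one about
      representatives. Absorption by the top class holds because the pair of
      \<open>Ident C D\<close> with \<open>a\<close> projects to \<open>Ident C D\<close>, which
      lies above every morphism out of \<open>D\<close>.\<close>
    unfolding Let_def classes_eq one_eq Inf_top_def
    by (intro conjI equiv_eqv po_comm_monoid_M ballI allI impI;
        (rule geq_cong Pair_cong; assumption)?)
      (auto simp: mult_cls order_cls_iff Pair_Out zero_Out Ident_Out geq_zero Ident_geq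
        Pair_geq cls_eq_iff eqv_iff geq_zero_Pair intro: Pair_mono del: equalityI)
qed

end
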